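(* Let $(S_n)$ be the elephant random walk with memory parameter $p\in[0,1]$ and first-step parameter $q\in[0,1]$. Whatever the value of $p$ in $[0,1]$, the estimator $\widehat{p}_n$ is a strongly consistent estimator of $p$, that is, $$\lim_{n\to\infty}\widehat{p}_n=p\qquad\text{almost surely}.$$
   Context: Elephant random walk (ERW): fix $q\in[0,1]$ and $p\in[0,1]$. Set $S_0=0$. The first step $X_1$ equals $+1$ with probability $q$ and $-1$ with probability $1-q$. For each $n\ge 1$, an integer $k$ is chosen uniformly at random among $1,\dots,n$ (independently of the past), and $X_{n+1}=X_k$ with probability $p$, $X_{n+1}=-X_k$ with probability $1-p$. The position is $S_{n+1}=S_n+X_{n+1}$, so $S_n=X_1+\cdots+X_n$. Equivalently, with $\mathcal{F}_n=\sigma(X_1,\dots,X_n)$, $\mathbb{P}(X_{n+1}=1\mid\mathcal{F}_n)=\frac12\bigl(1+(2p-1)\frac{S_n}{n}\bigr)$ and $\mathbb{P}(X_{n+1}=-1\mid\mathcal{F}_n)=\frac12\bigl(1-(2p-1)\frac{S_n}{n}\bigr)$ for all $n\ge1$. Estimator: for all $n\ge2$, $$\widehat{p}_n=\frac{\sum_{k=1}^{n-1}\frac{S_k}{k}\bigl(X_{k+1}+\frac{S_k}{k}\bigr)}{2\sum_{k=1}^{n-1}\bigl(\frac{S_k}{k}\bigr)^2}.$$ *)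

theory Defs
  imports "HOL-Probability.Probability"
begin

text \<open>
  The elephant random walk with memory parameter \<open>p\<close> and first-step parameter \<open>q\<close>, realised on a
  probability space \<open>M\<close>. The steps are \<open>X 1, X 2, \<dots>\<close> (\<open>X 0\<close> is unused). For \<open>n \<ge> 1\<close>, \<open>K n\<close> is the
  remembered time and \<open>R n\<close> says whether the remembered step is repeated or reversed. That the pair
  \<open>(K n, R n)\<close> has a product law expresses the three facts that \<open>K n\<close> is uniform on \<open>{1..n}\<close>, that
  \<open>R n\<close> holds with probability \<open>p\<close>, and that the two are independent; the past from which the pair
  is independent is the one generated by \<open>X 1, \<dots>, X n\<close>.
\<close>

locale elephant_random_walk = prob_space M
  for M :: "'a measure" +
  fixes p q :: real
    and X :: "nat \<Rightarrow> 'a \<Rightarrow> real"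
    and K :: "nat \<Rightarrow> 'a \<Rightarrow> nat"
    and R :: "nat \<Rightarrow> 'a \<Rightarrow> bool"
  assumes p_range: "p \<in> {0..1}"
    and q_range: "q \<in> {0..1}"
    and X_measurable: "\<And>n. n \<ge> 1 \<Longrightarrow> random_variable borel (X n)"
    and first_step_pos: "prob {\<omega> \<in> space M. X 1 \<omega> = 1} = q"
    and first_step_neg: "prob {\<omega> \<in> space M. X 1 \<omega> = - 1} = 1 - q"
    and choice_measurable:
      "\<And>n. n \<ge> 1 \<Longrightarrow> random_variable (count_space UNIV) (\<lambda>\<omega>. (K n \<omega>, R n \<omega>))"
    and choice_law:
      "\<And>n. n \<ge> 1 \<Longrightarrow> distr M (count_space UNIV) (\<lambda>\<omega>. (K n \<omega>, R n \<omega>)) =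
         measure_pmf (pair_pmf (pmf_of_set {1..n}) (bernoulli_pmf p))"
    and choice_indep_past:
      "\<And>n. n \<ge> 1 \<Longrightarrow> indep_set
         (sets (vimage_algebra (space M) (\<lambda>\<omega>. (K n \<omega>, R n \<omega>)) (count_space UNIV)))
         (sets (vimage_algebra (space M) (\<lambda>\<omega>. \<lambda>i\<in>{1..n}. X i \<omega>) (PiM {1..n} (\<lambda>_. borel))))"
    and next_step:
      "\<And>n \<omega>. n \<ge> 1 \<Longrightarrow> \<omega> \<in> space M \<Longrightarrow>
         X (Suc n) \<omega> = (if R n \<omega> then X (K n \<omega>) \<omega> else - X (K n \<omega>) \<omega>)"

definition erw_position :: "(nat \<Rightarrow> 'a \<Rightarrow> real) \<Rightarrow> nat \<Rightarrow> 'a \<Rightarrow> real" where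
  "erw_position X n \<omega> = (\<Sum>k=1..n. X k \<omega>)"

definition erw_estimator :: "(nat \<Rightarrow> 'a \<Rightarrow> real) \<Rightarrow> nat \<Rightarrow> 'a \<Rightarrow> real" where
  "erw_estimator X n \<omega> =
     (\<Sum>k=1..n - 1. erw_position X k \<omega> / real k * (X (k + 1) \<omega> + erw_position X k \<omega> / real k)) /
     (2 * (\<Sum>k=1..n - 1. (erw_position X k \<omega> / real k)\<^sup>2))"

end

theory Submission
  imports Defs
begin

text \<open>
  Put \<open>a = 2p - 1\<close>, \<open>y\<^sub>k = S\<^sub>k / k\<close>, \<open>\<epsilon>\<^sub>k\<^sub>+\<^sub>1 = X\<^sub>k\<^sub>+\<^sub>1 - a y\<^sub>k\<close> and \<open>v\<^sub>n = \<Sum>\<^sub>k y\<^sub>k\<^sup>2\<close>. The estimator equals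
  \<open>p + \<Sum>\<^sub>k y\<^sub>k \<epsilon>\<^sub>k\<^sub>+\<^sub>1 / (2 v\<^sub>n)\<close> and the \<open>\<epsilon>\<close> are bounded martingale differences. The martingale
  \<open>\<Sum>\<^sub>k y\<^sub>k \<epsilon>\<^sub>k\<^sub>+\<^sub>1 / (1 + v\<^sub>k)\<close> is bounded in \<open>L\<^sup>2\<close>, because \<open>\<Sum>\<^sub>k y\<^sub>k\<^sup>2 / (1 + v\<^sub>k)\<^sup>2 \<le> 1\<close> telescopes, so it
  converges almost surely. On this event Kronecker's lemma gives the claim as soon as \<open>v\<^sub>n\<close> is
  unbounded. If \<open>v\<^sub>n\<close> were bounded, the recursion for \<open>S\<^sub>n\<^sup>2 / n\<close> would show that \<open>S\<^sub>n\<^sup>2 / n\<close> is \<open>log n\<close> up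
  to bounded terms, hence \<open>y\<^sub>n\<^sup>2 \<ge> 1 / n\<close> eventually, which is not summable. No distinction between
  the diffusive, critical and superdiffusive regimes is needed.
\<close>

subsection \<open>Weighted sums and the deterministic recursion\<close>

text \<open>Summation by parts: up to sign, the error against \<open>c n * ?U (Suc n)\<close> is the
  sum of the nonnegative increments of \<open>c\<close> times partial sums bounded by
  \<open>B\<close>, and the increments telescope.\<close>

lemma abel_sum_bound:
  fixes c u :: "nat \<Rightarrow> real"
  assumes "mono c" and nonneg: "\<And>k. 0 \<le> c k"
    and bound: "\<And>n. n \<ge> m \<Longrightarrow> \<bar>\<Sum>k=m..<n. u k\<bar> \<le> B"
    and "m \<le> n"
  shows "\<bar>\<Sum>k=m..<Suc n. c k * u k\<bar> \<le> 2 * B * c n"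
proof -
  let ?U = "\<lambda>n. \<Sum>k=m..<n. u k"
  have B: "0 \<le> B" using bound[of m] by simp
  have "\<bar>(\<Sum>k=m..<Suc n. c k * u k) - c n * ?U (Suc n)\<bar> \<le> B * (c n - c m)"
    using \<open>m \<le> n\<close>
  proof (induction n rule: dec_induct)
    case base
    show ?case by simp
  next
    case (step n)
    have "(\<Sum>k=m..<Suc (Suc n). c k * u k) - c (Suc n) * ?U (Suc (Suc n))
        = ((\<Sum>k=m..<Suc n. c k * u k) - c n * ?U (Suc n)) - (c (Suc n) - c n) * ?U (Suc n)"
      using step.hyps by (simp add: algebra_simps)
    moreover have "\<bar>(c (Suc n) - c n) * ?U (Suc n)\<bar> \<le> (c (Suc n) - c n) * B"
      using bound[of "Suc n"] step.hyps monoD[OF \<open>mono c\<close>, of n "Suc n"]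
      by (simp add: abs_mult mult_left_mono del: sum.op_ivl_Suc)
    ultimately show ?case
      using step.IH by (simp add: algebra_simps del: sum.op_ivl_Suc)
  qed
  moreover have "\<bar>c n * ?U (Suc n)\<bar> \<le> c n * B"
    using bound[of "Suc n"] \<open>m \<le> n\<close> nonneg[of n]
    by (simp add: abs_mult mult_left_mono del: sum.op_ivl_Suc)
  moreover have "B * (c n - c m) \<le> B * c n"
    using B nonneg[of m] by (simp add: mult_left_mono)
  ultimately show ?thesis by (simp add: algebra_simps del: sum.op_ivl_Suc)
qed

text \<open>The Cauchy criterion makes the partial sums of a tail small, so Abel summation bounds
  the weighted tail by a small multiple of \<open>c n\<close>; the fixed head is outgrown by
  \<open>c n\<close>.\<close>

lemma kronecker:
  fixes c u :: "nat \<Rightarrow> real"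
  assumes "mono c" and nonneg: "\<And>k. 0 \<le> c k" and top: "filterlim c at_top sequentially"
    and "summable u"
  shows "(\<lambda>n. (\<Sum>k\<le>n. c k * u k) / c n) \<longlonglongrightarrow> 0"
proof (rule LIMSEQ_I)
  fix r :: real assume "0 < r"
  then obtain m where m: "\<And>n. n \<ge> m \<Longrightarrow> \<bar>\<Sum>k=m..<n. u k\<bar> < r / 4"
    using \<open>summable u\<close>[unfolded summable_Cauchy, rule_format, of "r / 4"] by auto
  let ?A = "\<Sum>k<m. c k * u k"
  \<comment> \<open>This threshold puts the head below \<open>r / 4 * c n\<close>, and the summand 1
    keeps \<open>c n\<close> positive. The tail takes at most \<open>r / 2 * c n\<close>.\<close>
  have "eventually (\<lambda>n. c n \<ge> 4 * \<bar>?A\<bar> / r + 1) sequentially"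
    using top by (auto simp: filterlim_at_top)
  then obtain n0 where n0: "\<And>n. n \<ge> n0 \<Longrightarrow> c n \<ge> 4 * \<bar>?A\<bar> / r + 1"
    by (auto simp: eventually_sequentially)
  have "\<bar>(\<Sum>k\<le>n. c k * u k) / c n\<bar> < r" if n: "n \<ge> max m n0" for n
  proof -
    have "0 \<le> 4 * \<bar>?A\<bar> / r" using \<open>0 < r\<close> by simp
    then have pos: "c n > 0" using n0[of n] n by simp
    have "4 * \<bar>?A\<bar> / r < c n" using n0[of n] n by simp
    then have A: "\<bar>?A\<bar> < r / 4 * c n" using \<open>0 < r\<close> by (simp add: field_simps)
    have "\<bar>\<Sum>k=m..<Suc n. c k * u k\<bar> \<le> 2 * (r / 4) * c n"
      using n m by (intro abel_sum_bound[OF \<open>mono c\<close> nonneg]) (auto intro: less_imp_le)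
    moreover have "(\<Sum>k\<le>n. c k * u k) = ?A + (\<Sum>k=m..<Suc n. c k * u k)"
      using n by (simp add: lessThan_Suc_atMost[symmetric] lessThan_atLeast0
          sum.atLeastLessThan_concat del: sum.op_ivl_Suc)
    ultimately have "\<bar>\<Sum>k\<le>n. c k * u k\<bar> < r * c n"
      using A pos \<open>0 < r\<close> mult_pos_pos[OF \<open>0 < r\<close> pos] by (simp del: sum.op_ivl_Suc)
    then show ?thesis using pos by (simp add: field_simps)
  qed
  then show "\<exists>N. \<forall>n\<ge>N. norm ((\<Sum>k\<le>n. c k * u k) / c n - 0) < r"
    by (intro exI[of _ "max m n0"]) (auto simp del: abs_divide)
qed

section \<open>Divergence of the sum of squares and its consequence for the noise\<close>

lemma not_summable_inverse_Suc: "\<not> summable (\<lambda>n. 1 / (real n + 1))"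
  using not_summable_harmonic[where ?'a = real]
  by (subst (asm) summable_Suc_iff[symmetric]) (simp add: field_simps)

text \<open>If \<open>\<Sum>y\<^sub>k\<^sup>2\<close> were finite, then the recursion for \<open>t\<^sub>n = (n + 1) y\<^sub>n\<^sup>2\<close> would be driven by the
  harmonic series up to bounded terms, so that \<open>y\<^sub>n\<^sup>2 \<ge> 1 / (n + 1)\<close> eventually.\<close>

lemma normalised_walk_not_square_summable:
  fixes y e :: "nat \<Rightarrow> real" and a :: real
  defines "v \<equiv> \<lambda>n. \<Sum>k\<le>n. (y k)\<^sup>2"
  assumes a: "\<bar>a\<bar> \<le> 1"
    and unit: "\<And>n. (a * y n + e n)\<^sup>2 = 1"
    and rec: "\<And>n. real (n + 2) * y (Suc n) = real (n + 1) * y n + (a * y n + e n)"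
    and conv: "summable (\<lambda>k. y k / (1 + v k) * e k)"
  shows "\<not> summable (\<lambda>k. (y k)\<^sup>2)"
proof
  assume sq: "summable (\<lambda>k. (y k)\<^sup>2)"
  \<comment> \<open>The factor left on the cross term when the squared recursion is divided by
    \<open>n + 2\<close>.\<close>
  define h where "h n = real (n + 1) / real (n + 2)" for n
  have h_bounds: "0 \<le> h n" "h n \<le> 1" for n by (simp_all add: h_def)
  have h_mult: "real (n + 2) * h n = real (n + 1)" for n by (simp add: h_def)
  define L where "L = (\<Sum>k. (y k)\<^sup>2)"
  have v_mono: "mono v" unfolding v_def by (intro monoI sum_mono2) auto
  have v_nonneg: "0 \<le> v n" for n unfolding v_def by (simp add: sum_nonneg)
  have v_le: "v n \<le> L" for n
    unfolding v_def L_def by (rule sum_le_suminf[OF sq]) auto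
  obtain B where B: "\<And>n. \<bar>\<Sum>k<n. y k / (1 + v k) * e k\<bar> \<le> B"
    using convergent_imp_Bseq[OF conv[unfolded summable_iff_convergent]]
    unfolding Bseq_def real_norm_def by blast
  have B0: "0 \<le> B" using B[of 0] by simp
  have h_mono: "mono h" by (intro monoI) (simp add: h_def field_simps)
  \<comment> \<open>Multiplying the summands of \<open>conv\<close> by this nondecreasing factor
    restores \<open>h k * (y k * e k)\<close>, so Abel summation bounds their partial sums uniformly
    in \<open>n\<close>.\<close>
  have "mono (\<lambda>n. (1 + v n) * h n)"
    using v_nonneg h_bounds monoD[OF v_mono] monoD[OF h_mono]
    by (intro monoI mult_mono) (auto intro: add_nonneg_nonneg)
  then have M: "\<bar>\<Sum>k<Suc n. h k * (y k * e k)\<bar> \<le> 2 * B * (1 + L)" for n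
  proof -
    have nz: "1 + v k \<noteq> 0" for k using v_nonneg[of k] by linarith
    have "\<bar>\<Sum>k=0..<Suc n. ((1 + v k) * h k) * (y k / (1 + v k) * e k)\<bar> 
       \<le> 2 * B * ((1 + v n) * h n)"
      using \<open>mono (\<lambda>n. (1 + v n) * h n)\<close> v_nonneg h_bounds B
      by (intro abel_sum_bound) (auto simp: lessThan_atLeast0 intro: add_nonneg_nonneg)
    also have "(1 + v n) * h n \<le> (1 + L) * 1"
      using v_le v_nonneg[of n] h_bounds order_trans[OF v_nonneg v_le] by (intro mult_mono) auto
    then have "2 * B * ((1 + v n) * h n) \<le> 2 * B * (1 + L)"
      using B0 by (intro mult_left_mono) auto
    also have "(\<lambda>k. ((1 + v k) * h k) * (y k / (1 + v k) * e k)) = (\<lambda>k. h k * (y k * e k))"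
      using nz by (simp add: fun_eq_iff field_simps)
    finally show ?thesis by (simp add: lessThan_atLeast0 del: sum.op_ivl_Suc)
  qed
  define t where "t = (\<lambda>n. real (n + 1) * (y n)\<^sup>2)"
  \<comment> \<open>The squared recursion divided by \<open>n + 2\<close>: \<open>2 * a\<close>
    comes from the drift, \<open>- 1\<close> from
    \<open>(n + 1)^2 / (n + 2) = (n + 1) - h n\<close>, and the last term from the unit square of
    the step.\<close>
  have t_step: "t (Suc n) = t n + (2 * a - 1) * h n * (y n)\<^sup>2 + 2 * (h n * (y n * e n)) + 1 / real (n + 2)"
    for n
  proof -
    have "real (n + 2) * t (Suc n) = (real (n + 2) * y (Suc n))\<^sup>2"
      by (simp add: t_def power2_eq_square)
    also have "\<dots> = (real (n + 1) * y n)\<^sup>2 + 2 * real (n + 1) * y n * (a * y n + e n) + 1"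
      unfolding rec power2_sum[of "real (n + 1) * y n"] unit by (simp add: algebra_simps)
    also have "\<dots> = real (n + 2) * (t n + (2 * a - 1) * h n * (y n)\<^sup>2 + 2 * (h n * (y n * e n)) + 1 / real (n + 2))"
      unfolding t_def distrib_left using h_mult[of n]
      by (simp add: power2_eq_square del: of_nat_add) algebra
    finally show ?thesis by (simp del: of_nat_add)
  qed
  have t_lower: "t (Suc n) \<ge> - 3 * v n + 2 * (\<Sum>k<Suc n. h k * (y k * e k)) + (\<Sum>k<Suc n. 1 / real (k + 2))"
    for n
  proof -
    \<comment> \<open>The 3 bounds \<open>\<bar>2 * a - 1\<bar>\<close> for
      \<open>\<bar>a\<bar> \<le> 1\<close>, and \<open>h n \<le> 1\<close>.\<close>
    have step: "t (Suc n) \<ge> t n - 3 * (y n)\<^sup>2 + 2 * (h n * (y n * e n)) + 1 / real (n + 2)" for n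
    proof -
      have "\<bar>(2 * a - 1) * h n\<bar> \<le> 3 * 1"
        unfolding abs_mult using a h_bounds by (intro mult_mono) auto
      then have "- 3 * (y n)\<^sup>2 \<le> (2 * a - 1) * h n * (y n)\<^sup>2"
        by (intro mult_right_mono) auto
      then show ?thesis unfolding t_step by linarith
    qed
    have "t 0 \<ge> 0" by (simp add: t_def)
    then show ?thesis
    proof (induction n)
      case 0 then show ?case using step[of 0] by (simp add: v_def)
    next
      case (Suc n)
      then show ?case using step[of "Suc n"] by (simp add: v_def)
    qed
  qed
  have "\<not> summable (\<lambda>n. 1 / (real (n + 2)))"
    using not_summable_inverse_Suc
    by (subst (asm) summable_Suc_iff[symmetric]) (simp add: add_ac)
  \<comment> \<open>The terms \<open>3 * L\<close> and \<open>4 * B * (1 + L)\<close> absorb the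
    first two sums in \<open>t_lower\<close>; the remaining 1 forces
    \<open>t (Suc n) \<ge> 1\<close>.\<close>
  then obtain n0 where n0: "(\<Sum>k<n0. 1 / real (k + 2)) > 1 + 3 * L + 4 * B * (1 + L)"
    by (meson summableI_nonneg_bounded not_le zero_le_divide_1_iff of_nat_0_le_iff)
  have "norm (1 / (real (n + 1) + 1)) \<le> (y (Suc n))\<^sup>2" if "n \<ge> n0" for n
  proof -
    have "(\<Sum>k<n0. 1 / real (k + 2)) \<le> (\<Sum>k<Suc n. 1 / real (k + 2))"
      using that by (intro sum_mono2) auto
    then have "t (Suc n) \<ge> 1"
      using t_lower[of n] M[of n] v_le[of n] n0 by linarith
    then show ?thesis by (simp add: t_def field_simps)
  qed
  moreover have "summable (\<lambda>n. (y (Suc n))\<^sup>2)"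
    using sq by (subst summable_Suc_iff)
  ultimately have "summable (\<lambda>n. 1 / (real (n + 1) + 1))"
    by (rule summable_comparison_test'[rotated])
  then show False
    using \<open>\<not> summable (\<lambda>n. 1 / (real (n + 2)))\<close> by (simp add: add_ac)
qed

text \<open>Divergence of \<open>v\<close> comes from the preceding lemma. Kronecker's lemma then
  applies with the multipliers \<open>1 + v\<close>, which cancel the denominators in
  \<open>conv\<close>.\<close>

lemma normalised_walk_noise_ratio:
  fixes y e :: "nat \<Rightarrow> real" and a :: real
  defines "v \<equiv> \<lambda>n. \<Sum>k\<le>n. (y k)\<^sup>2"
  assumes a: "\<bar>a\<bar> \<le> 1"
    and unit: "\<And>n. (a * y n + e n)\<^sup>2 = 1"
    and rec: "\<And>n. real (n + 2) * y (Suc n) = real (n + 1) * y n + (a * y n + e n)"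
    and conv: "summable (\<lambda>k. y k / (1 + v k) * e k)"
  shows "filterlim v at_top sequentially"
    and "(\<lambda>n. (\<Sum>k\<le>n. y k * e k) / v n) \<longlonglongrightarrow> 0"
proof -
  have v_mono: "mono v" unfolding v_def by (intro monoI sum_mono2) auto
  have v_nonneg: "0 \<le> v n" for n unfolding v_def by (simp add: sum_nonneg)
  have "\<not> summable (\<lambda>k. (y k)\<^sup>2)"
    using normalised_walk_not_square_summable[OF a unit rec] conv by (simp add: v_def)
  then have large: "\<exists>n. v n > Z" for Z
    unfolding v_def by (meson summableI_nonneg_bounded not_le zero_le_power2 bounded_imp_summable)
  show v_top: "filterlim v at_top sequentially"
    unfolding filterlim_at_top eventually_sequentially
    using large monoD[OF v_mono] by (meson less_imp_le order_trans)
  have top: "filterlim (\<lambda>n. 1 + v n) at_top sequentially"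
    by (rule filterlim_tendsto_add_at_top[OF tendsto_const v_top])
  have "mono (\<lambda>n. 1 + v n)" using v_mono by (simp add: mono_def)
  from kronecker[OF this _ top conv]
  have "(\<lambda>n. (\<Sum>k\<le>n. (1 + v k) * (y k / (1 + v k) * e k)) / (1 + v n)) \<longlonglongrightarrow> 0"
    using v_nonneg by (simp add: add_nonneg_nonneg)
  moreover have "(1 + v k) * (y k / (1 + v k) * e k) = y k * e k" for k
    using v_nonneg[of k] by (simp add: field_simps)
  ultimately have lim: "(\<lambda>n. (\<Sum>k\<le>n. y k * e k) / (1 + v n)) \<longlonglongrightarrow> 0" by simp
  \<comment> \<open>This factor, tending to 1, replaces the denominator \<open>1 + v n\<close> by
    \<open>v n\<close>.\<close>
  have "(\<lambda>n. 1 + 1 / v n) \<longlonglongrightarrow> 1 + 0"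
    by (intro tendsto_intros tendsto_divide_0[OF tendsto_const] filterlim_at_top_imp_at_infinity v_top)
  from tendsto_mult[OF lim this]
  have "(\<lambda>n. (\<Sum>k\<le>n. y k * e k) / (1 + v n) * (1 + 1 / v n)) \<longlonglongrightarrow> 0" by simp
  moreover have "eventually (\<lambda>n. v n > 0) sequentially"
    using v_top by (simp add: filterlim_at_top_dense)
  then have "eventually (\<lambda>n. (\<Sum>k\<le>n. y k * e k) / (1 + v n) * (1 + 1 / v n)
      = (\<Sum>k\<le>n. y k * e k) / v n) sequentially"
    by eventually_elim (simp add: divide_simps)
  ultimately show "(\<lambda>n. (\<Sum>k\<le>n. y k * e k) / v n) \<longlonglongrightarrow> 0"
    by (rule Lim_transform_eventually)
qed

subsection \<open>Transforms of bounded martingale differences\<close>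

text \<open>Only the orthogonality to bounded predictable weights is recorded, so that no conditional
  expectation has to be handled.\<close>

locale bounded_martingale_differences = prob_space M for M :: "'a measure" +
  fixes F :: "nat \<Rightarrow> 'a measure" and e :: "nat \<Rightarrow> 'a \<Rightarrow> real" and c :: real
  assumes subalg: "\<And>n. subalgebra M (F n)"
    and filtration: "\<And>m n. m \<le> n \<Longrightarrow> sets (F m) \<subseteq> sets (F n)"
    and adapted: "\<And>n. e n \<in> borel_measurable (F (Suc n))"
    and bounded: "\<And>n. AE \<omega> in M. \<bar>e n \<omega>\<bar> \<le> c"
    and orthogonal: "\<And>n W B. W \<in> borel_measurable (F n) \<Longrightarrow> AE \<omega> in M. \<bar>W \<omega>\<bar> \<le> B \<Longrightarrow>
      expectation (\<lambda>\<omega>. W \<omega> * e n \<omega>) = 0"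
begin

lemma measurable_filtration:
  assumes "f \<in> borel_measurable (F m)" "m \<le> n"
  shows "f \<in> borel_measurable (F n)"
proof (rule measurable_from_subalg[OF _ assms(1)])
  show "subalgebra (F n) (F m)"
    using subalg[of n] subalg[of m] filtration[OF assms(2)] by (simp add: subalgebra_def)
qed

lemma measurable_weight:
  "f \<in> borel_measurable (F n) \<Longrightarrow> f \<in> borel_measurable M"
  using measurable_from_subalg[OF subalg] .

lemma measurable_noise: "e n \<in> borel_measurable M"
  using measurable_weight[OF adapted] .

lemma integrable_AE_bounded:
  fixes f :: "'a \<Rightarrow> real"
  assumes "f \<in> borel_measurable M" "AE \<omega> in M. \<bar>f \<omega>\<bar> \<le> B"
  shows "integrable M f"
  using assms by (intro integrable_const_bound[of _ B]) auto

text \<open>The martingale transform (discrete stochastic integral). Ending at \<open>k < n\<close>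
  makes it \<open>F n\<close>-measurable for adapted weights, because \<open>e k\<close> is known at
  time \<open>Suc k\<close>.\<close>

definition transform :: "(nat \<Rightarrow> 'a \<Rightarrow> real) \<Rightarrow> nat \<Rightarrow> 'a \<Rightarrow> real" where
  "transform W n \<omega> = (\<Sum>k<n. W k \<omega> * e k \<omega>)"

lemma transform_Suc: "transform W (Suc n) \<omega> = transform W n \<omega> + W n \<omega> * e n \<omega>"
  by (simp add: transform_def)

lemma transform_0 [simp]: "transform W 0 \<omega> = 0"
  by (simp add: transform_def)

lemma transform_adapted:
  assumes "\<And>n. W n \<in> borel_measurable (F n)"
  shows "transform W n \<in> borel_measurable (F n)"
proof -
  have "(\<lambda>\<omega>. W k \<omega> * e k \<omega>) \<in> borel_measurable (F n)" if "k < n" for k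
    using that by (intro borel_measurable_times measurable_filtration[OF assms]
        measurable_filtration[OF adapted]) auto
  then show ?thesis
    unfolding transform_def[abs_def] by (intro borel_measurable_sum) auto
qed

lemma weight_noise_bounded:
  assumes "AE \<omega> in M. \<bar>W \<omega>\<bar> \<le> B"
  shows "AE \<omega> in M. \<bar>W \<omega> * e n \<omega>\<bar> \<le> B * c"
  using assms bounded[of n]
proof eventually_elim
  case (elim \<omega>)
  have "0 \<le> B" using elim(1) by linarith
  then show ?case unfolding abs_mult using elim by (intro mult_mono) auto
qed

text \<open>A crude bound growing with \<open>n\<close>. It serves integrability and makes products
  with the transform admissible in \<open>orthogonal\<close>; uniform control comes from second
  moments.\<close>

lemma transform_bounded:
  assumes "\<And>n. AE \<omega> in M. \<bar>W n \<omega>\<bar> \<le> B"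
  shows "AE \<omega> in M. \<bar>transform W n \<omega>\<bar> \<le> real n * (B * c)"
proof (induction n)
  case (Suc n)
  then show ?case using weight_noise_bounded[OF assms[of n], of n]
    by eventually_elim (simp add: transform_Suc algebra_simps)
qed simp

section \<open>Second moments, maximal inequality and almost sure convergence of transforms\<close>

lemma integrable_transform_square:
  assumes W: "\<And>n. W n \<in> borel_measurable (F n)" and B: "\<And>n. AE \<omega> in M. \<bar>W n \<omega>\<bar> \<le> B"
  shows "integrable M (\<lambda>\<omega>. (transform W n \<omega>)\<^sup>2)"
proof (rule integrable_AE_bounded)
  show "(\<lambda>\<omega>. (transform W n \<omega>)\<^sup>2) \<in> borel_measurable M"
    using measurable_weight[OF transform_adapted[of W n, OF W]] by (intro borel_measurable_power)
  show "AE \<omega> in M. \<bar>(transform W n \<omega>)\<^sup>2\<bar> \<le> (real n * (B * c))\<^sup>2"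
    using transform_bounded[of W B n, OF B]
    by eventually_elim (simp add: power2_le_iff_abs_le order_trans[OF abs_ge_zero])
qed

lemma integrable_weight_square:
  fixes W :: "'a \<Rightarrow> real"
  assumes "W \<in> borel_measurable (F n)" and "AE \<omega> in M. \<bar>W \<omega>\<bar> \<le> B"
  shows "integrable M (\<lambda>\<omega>. (W \<omega>)\<^sup>2)"
proof (rule integrable_AE_bounded)
  show "(\<lambda>\<omega>. (W \<omega>)\<^sup>2) \<in> borel_measurable M"
    using measurable_weight[OF assms(1)] by (intro borel_measurable_power)
  show "AE \<omega> in M. \<bar>(W \<omega>)\<^sup>2\<bar> \<le> B\<^sup>2"
    using assms(2) by eventually_elim (simp add: power2_le_iff_abs_le order_trans[OF abs_ge_zero])
qed

text \<open>Pythagoras: in the square of each increment step the cross term vanishes, since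
  transform times weight is again a bounded \<open>F n\<close>-measurable weight. The bound
  \<open>c\<close> on the noise handles the remaining square.\<close>

lemma transform_second_moment:
  assumes W: "\<And>n. W n \<in> borel_measurable (F n)" and B: "\<And>n. AE \<omega> in M. \<bar>W n \<omega>\<bar> \<le> B"
  shows "expectation (\<lambda>\<omega>. (transform W n \<omega>)\<^sup>2) \<le> c\<^sup>2 * (\<Sum>k<n. expectation (\<lambda>\<omega>. (W k \<omega>)\<^sup>2))"
proof (induction n)
  case (Suc n)
  let ?Z = "transform W n"
  have [measurable]: "?Z \<in> borel_measurable M" "W n \<in> borel_measurable M" "e n \<in> borel_measurable M"
    using measurable_weight[OF transform_adapted[of W n, OF W]] measurable_weight[OF W]
      measurable_noise by auto
  have ZW: "AE \<omega> in M. \<bar>?Z \<omega> * W n \<omega>\<bar> \<le> real n * (B * c) * B"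
    using transform_bounded[of W B n, OF B] B[of n]
    by eventually_elim (auto simp: abs_mult intro!: mult_mono order_trans[OF abs_ge_zero])
  have orth: "expectation (\<lambda>\<omega>. ?Z \<omega> * W n \<omega> * e n \<omega>) = 0"
    using transform_adapted[of W n, OF W] W by (intro orthogonal[OF _ ZW]) auto
  have i1: "integrable M (\<lambda>\<omega>. (?Z \<omega>)\<^sup>2)" by (rule integrable_transform_square[OF W B])
  have i2: "integrable M (\<lambda>\<omega>. ?Z \<omega> * W n \<omega> * e n \<omega>)"
    by (intro integrable_AE_bounded[OF _ weight_noise_bounded[OF ZW]]) measurable
  have i3: "integrable M (\<lambda>\<omega>. (W n \<omega> * e n \<omega>)\<^sup>2)"
  proof (rule integrable_AE_bounded)
    show "AE \<omega> in M. \<bar>(W n \<omega> * e n \<omega>)\<^sup>2\<bar> \<le> (B * c)\<^sup>2"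
      using weight_noise_bounded[OF B[of n], of n]
      by eventually_elim (simp add: power2_le_iff_abs_le order_trans[OF abs_ge_zero])
  qed measurable
  have i4: "integrable M (\<lambda>\<omega>. (W n \<omega>)\<^sup>2)" by (rule integrable_weight_square[OF W B])
  have "(\<lambda>\<omega>. (transform W (Suc n) \<omega>)\<^sup>2)
      = (\<lambda>\<omega>. (?Z \<omega>)\<^sup>2 + 2 * (?Z \<omega> * W n \<omega> * e n \<omega>) + (W n \<omega> * e n \<omega>)\<^sup>2)"
    by (auto simp: transform_Suc power2_sum algebra_simps)
  then have "expectation (\<lambda>\<omega>. (transform W (Suc n) \<omega>)\<^sup>2)
      = expectation (\<lambda>\<omega>. (?Z \<omega>)\<^sup>2) + expectation (\<lambda>\<omega>. (W n \<omega> * e n \<omega>)\<^sup>2)"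
    using i1 i2 i3 orth by simp
  moreover have "expectation (\<lambda>\<omega>. (W n \<omega> * e n \<omega>)\<^sup>2) \<le> expectation (\<lambda>\<omega>. c\<^sup>2 * (W n \<omega>)\<^sup>2)"
  proof (rule integral_mono_AE)
    show "AE \<omega> in M. (W n \<omega> * e n \<omega>)\<^sup>2 \<le> c\<^sup>2 * (W n \<omega>)\<^sup>2"
      using bounded[of n]
    proof eventually_elim
      case (elim \<omega>)
      then have "(e n \<omega>)\<^sup>2 \<le> c\<^sup>2" using abs_le_square_iff[of "e n \<omega>" c] by linarith
      then show ?case by (simp add: power_mult_distrib mult_left_mono mult.commute[of "c\<^sup>2"])
    qed
  qed (use i3 i4 in auto)
  ultimately show ?case using Suc.IH i4 by (simp add: algebra_simps)
qed simp

text \<open>Kolmogorov's maximal inequality: once the bound \<open>r\<close> is exceeded the weights are switched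
  off, so that the stopped transform keeps the excess until time \<open>n\<close> and Chebyshev applies there.\<close>

lemma transform_maximal_inequality:
  assumes W: "\<And>n. W n \<in> borel_measurable (F n)" and B: "\<And>n. AE \<omega> in M. \<bar>W n \<omega>\<bar> \<le> B"
    and r: "r > 0"
  shows "prob {\<omega> \<in> space M. \<exists>j\<in>{m..n}. \<bar>transform W j \<omega> - transform W m \<omega>\<bar> \<ge> r}
    \<le> c\<^sup>2 * (\<Sum>k=m..<n. expectation (\<lambda>\<omega>. (W k \<omega>)\<^sup>2)) / r\<^sup>2"
proof -
  let ?D = "\<lambda>j \<omega>. \<bar>transform W j \<omega> - transform W m \<omega>\<bar>"
  \<comment> \<open>No excess up to time \<open>k\<close>: this is known at time \<open>k\<close>,
    so \<open>W'\<close> is still predictable. The condition \<open>m \<le> k\<close> also switches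
    off the weights before \<open>m\<close>.\<close>
  define A where "A k = {\<omega> \<in> space M. m \<le> k \<and> (\<forall>j\<in>{m..k}. ?D j \<omega> < r)}" for k
  define W' where "W' k \<omega> = W k \<omega> * indicator (A k) \<omega>" for k \<omega>
  have spF: "space (F k) = space M" for k using subalg by (simp add: subalgebra_def)
  have "A k \<in> sets (F k)" for k
  proof (cases "m \<le> k")
    case True
    have [measurable]: "transform W j \<in> borel_measurable (F k)" if "j \<le> k" for j
      using measurable_filtration[OF transform_adapted[of W, OF W] that] .
    have *: "{\<omega> \<in> space M. ?D j \<omega> < r} \<in> sets (F k)" if "j \<in> {m..k}" for j
    proof -
      have [measurable]: "transform W j \<in> borel_measurable (F k)" "transform W m \<in> borel_measurable (F k)"
        using that True by auto
      have "{\<omega> \<in> space (F k). ?D j \<omega> < r} \<in> sets (F k)" by measurable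
      then show ?thesis by (simp add: spF)
    qed
    have "A k = (\<Inter>j\<in>{m..k}. {\<omega> \<in> space M. ?D j \<omega> < r})"
      using True by (auto simp: A_def)
    also have "\<dots> \<in> sets (F k)" using True * by (intro sets.finite_INT) auto
    finally show ?thesis .
  next
    case False
    then have "A k = {}" by (auto simp: A_def)
    then show ?thesis by simp
  qed
  then have W': "W' k \<in> borel_measurable (F k)" for k
    unfolding W'_def[abs_def] using W by (intro borel_measurable_times borel_measurable_indicator)
  have W'_le: "\<bar>W' k \<omega>\<bar> \<le> \<bar>W k \<omega>\<bar>" for k \<omega>
    by (simp add: W'_def indicator_def)
  have B': "AE \<omega> in M. \<bar>W' k \<omega>\<bar> \<le> B" for k
    using B[of k] by eventually_elim (rule order_trans[OF W'_le])
  have "{\<omega> \<in> space M. \<exists>j\<in>{m..n}. ?D j \<omega> \<ge> r} \<subseteq> {\<omega> \<in> space M. \<bar>transform W' n \<omega>\<bar> \<ge> r}"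
  proof (intro subsetI CollectI conjI; clarsimp)
    fix \<omega> i assume \<omega>: "\<omega> \<in> space M" and i: "m \<le> i" "i \<le> n" "r \<le> ?D i \<omega>"
    \<comment> \<open>The first passage time; the weights survive exactly on
      \<open>{m..<j}\<close>.\<close>
    define j where "j = (LEAST j. m \<le> j \<and> r \<le> ?D j \<omega>)"
    have j: "m \<le> j" "r \<le> ?D j \<omega>" and "j \<le> i"
      using LeastI[of "\<lambda>j. m \<le> j \<and> r \<le> ?D j \<omega>" i] Least_le[of "\<lambda>j. m \<le> j \<and> r \<le> ?D j \<omega>" i] i
      by (auto simp: j_def)
    have before: "?D l \<omega> < r" if "m \<le> l" "l < j" for l
      using not_less_Least[of l "\<lambda>j. m \<le> j \<and> r \<le> ?D j \<omega>"] that by (auto simp: j_def)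
    have W'_eq: "W' k \<omega> = (if m \<le> k \<and> k < j then W k \<omega> else 0)" for k
    proof (cases "m \<le> k \<and> k < j")
      case True
      then show ?thesis using before \<omega> by (auto simp: W'_def A_def)
    next
      case False
      then have "\<omega> \<notin> A k" using j by (force simp: A_def)
      then show ?thesis using False by (auto simp: W'_def)
    qed
    \<comment> \<open>As \<open>j \<le> n\<close>, the stopped transform at time \<open>n\<close> is
      frozen at its value at first passage.\<close>
    have "transform W' n \<omega> = (\<Sum>k\<in>{m..<j}. W k \<omega> * e k \<omega>)"
      unfolding transform_def W'_eq using \<open>j \<le> i\<close> i
      by (intro sum.mono_neutral_cong_right) auto
    also have "\<dots> = transform W j \<omega> - transform W m \<omega>"
      unfolding transform_def lessThan_atLeast0 using j
      by (subst sum_diff_nat_ivl) auto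
    finally show "r \<le> \<bar>transform W' n \<omega>\<bar>" using j by simp
  qed
  moreover have [measurable]: "transform W' n \<in> borel_measurable M"
    using measurable_weight[OF transform_adapted[of W' n, OF W']] .
  ultimately have "prob {\<omega> \<in> space M. \<exists>j\<in>{m..n}. ?D j \<omega> \<ge> r} \<le> prob {\<omega> \<in> space M. \<bar>transform W' n \<omega>\<bar> \<ge> r}"
    by (intro finite_measure_mono) auto
  also have "\<dots> \<le> expectation (\<lambda>\<omega>. (transform W' n \<omega>)\<^sup>2) / r\<^sup>2"
    using integrable_transform_square[OF W' B'] r by (intro second_moment_method) auto
  also have "\<dots> \<le> c\<^sup>2 * (\<Sum>k<n. expectation (\<lambda>\<omega>. (W' k \<omega>)\<^sup>2)) / r\<^sup>2"
    by (intro divide_right_mono transform_second_moment[OF W' B']) simp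
  also have "(\<Sum>k<n. expectation (\<lambda>\<omega>. (W' k \<omega>)\<^sup>2)) = (\<Sum>k=m..<n. expectation (\<lambda>\<omega>. (W' k \<omega>)\<^sup>2))"
    by (rule sum.mono_neutral_right) (auto simp: W'_def A_def)
  also have "(\<Sum>k=m..<n. expectation (\<lambda>\<omega>. (W' k \<omega>)\<^sup>2)) \<le> (\<Sum>k=m..<n. expectation (\<lambda>\<omega>. (W k \<omega>)\<^sup>2))"
    using W'_le by (intro sum_mono integral_mono integrable_weight_square[OF W B]
        integrable_weight_square[OF W' B']) (simp add: abs_le_square_iff)
  finally show ?thesis by (simp add: divide_right_mono mult_left_mono)
qed

text \<open>By the maximal inequality, an oscillation of size \<open>r\<close> after time
  \<open>m\<close> has probability at most a multiple of the tail of the second moments from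
  \<open>m\<close> on, which vanishes as \<open>m\<close> grows. Hence the paths are almost surely
  Cauchy.\<close>

lemma transform_AE_convergent:
  assumes W: "\<And>n. W n \<in> borel_measurable (F n)" and B: "\<And>n. AE \<omega> in M. \<bar>W n \<omega>\<bar> \<le> B"
    and summable: "summable (\<lambda>k. expectation (\<lambda>\<omega>. (W k \<omega>)\<^sup>2))"
  shows "AE \<omega> in M. convergent (\<lambda>n. transform W n \<omega>)"
proof -
  let ?D = "\<lambda>m j \<omega>. \<bar>transform W j \<omega> - transform W m \<omega>\<bar>"
  let ?w = "\<lambda>k. expectation (\<lambda>\<omega>. (W k \<omega>)\<^sup>2)"
  have [measurable]: "transform W n \<in> borel_measurable M" for n
    using measurable_weight[OF transform_adapted[of W n, OF W]] .
  have small: "AE \<omega> in M. \<exists>m. \<forall>j\<ge>m. ?D m j \<omega> < r" if r: "r > 0" for r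
  proof -
    \<comment> \<open>The bad event asks for an oscillation after every \<open>m\<close>, so it lies
      in the exceptional event of each single \<open>m\<close>.\<close>
    let ?N = "{\<omega> \<in> space M. \<forall>m. \<exists>j\<ge>m. ?D m j \<omega> \<ge> r}"
    have bound: "prob ?N \<le> c\<^sup>2 * (\<Sum>k. ?w (k + m)) / r\<^sup>2" for m
    proof -
      let ?E = "\<lambda>n. {\<omega> \<in> space M. \<exists>j\<in>{m..n}. ?D m j \<omega> \<ge> r}"
      have "prob (?E n) \<le> c\<^sup>2 * (\<Sum>k. ?w (k + m)) / r\<^sup>2" for n
      proof -
        \<comment> \<open>For \<open>n < m\<close> both sums are empty, the right one by truncated
          subtraction.\<close>
        have "(\<Sum>k=m..<n. ?w k) = (\<Sum>k<n - m. ?w (k + m))"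
          by (cases "m \<le> n") (auto simp: sum.atLeastLessThan_shift_0[of _ m n] lessThan_atLeast0 add.commute)
        also have "\<dots> \<le> (\<Sum>k. ?w (k + m))"
          using summable by (intro sum_le_suminf) (auto simp: summable_iff_shift[of ?w])
        finally show ?thesis
          using transform_maximal_inequality[OF W B r, of m n]
          by (elim order_trans) (intro divide_right_mono mult_left_mono, auto)
      qed
      \<comment> \<open>Continuity from below removes the time horizon \<open>n\<close>.\<close>
      moreover have "(\<lambda>n. prob (?E n)) \<longlonglongrightarrow> prob (\<Union>n. ?E n)"
        by (rule finite_Lim_measure_incseq) (auto simp: incseq_def)
      ultimately have "prob (\<Union>n. ?E n) \<le> c\<^sup>2 * (\<Sum>k. ?w (k + m)) / r\<^sup>2"
        by (intro LIMSEQ_le_const2) auto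
      moreover have "prob ?N \<le> prob (\<Union>n. ?E n)"
        by (rule finite_measure_mono) fastforce+
      ultimately show ?thesis by simp
    qed
    have "(\<lambda>m. c\<^sup>2 * (\<Sum>k. ?w (k + m)) / r\<^sup>2) \<longlonglongrightarrow> c\<^sup>2 * 0 / r\<^sup>2"
      by (intro tendsto_intros suminf_exist_split2 summable) (use r in auto)
    then have "prob ?N \<le> 0"
      using bound by (intro LIMSEQ_le_const[of "\<lambda>m. c\<^sup>2 * (\<Sum>k. ?w (k + m)) / r\<^sup>2"]) auto
    then have "prob ?N = 0" by (simp add: measure_le_0_iff)
    then have "AE \<omega> in M. \<not> (\<forall>m. \<exists>j\<ge>m. ?D m j \<omega> \<ge> r)"
      by (subst (asm) prob_Collect_eq_0) auto
    then show ?thesis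
      by eventually_elim (meson not_le)
  qed
  \<comment> \<open>Restricting to countably many radii lets the null sets be united.\<close>
  have "AE \<omega> in M. \<forall>i. \<exists>m. \<forall>j\<ge>m. ?D m j \<omega> < 1 / real (Suc i)"
    unfolding AE_all_countable by (intro allI small) simp
  then show ?thesis
  proof eventually_elim
    case (elim \<omega>)
    have "Cauchy (\<lambda>n. transform W n \<omega>)"
    proof (rule metric_CauchyI)
      fix r :: real assume "r > 0"
      then obtain i where i: "1 / real (Suc i) < r / 2"
        using nat_approx_posE[of "r / 2"] by auto
      obtain m where m: "\<And>j. j \<ge> m \<Longrightarrow> ?D m j \<omega> < 1 / real (Suc i)" using elim by blast
      have "dist (transform W j \<omega>) (transform W k \<omega>) < r" if "j \<ge> m" "k \<ge> m" for j k
        using m[OF that(1)] m[OF that(2)] i unfolding dist_real_def by linarith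
      then show "\<exists>m. \<forall>j\<ge>m. \<forall>k\<ge>m. dist (transform W j \<omega>) (transform W k \<omega>) < r" by blast
    qed
    then show ?case by (simp add: Cauchy_convergent_iff)
  qed
qed

end

subsection \<open>The elephant random walk\<close>

text \<open>The sigma-algebras generated by \<open>W\<close> and by the indicator of
  \<open>A\<close> lie in \<open>H\<close> and \<open>G\<close>, so the two variables are
  independent and the expectation of their product factors.\<close>

lemma (in prob_space) expectation_indep_sets:
  fixes W :: "'a \<Rightarrow> real"
  assumes indep: "indep_set (sets G) (sets H)" and sp: "space G = space M" "space H = space M"
    and W: "W \<in> borel_measurable H" and A: "A \<in> sets G" and int: "integrable M W"
  shows "expectation (\<lambda>\<omega>. W \<omega> * indicator A \<omega>) = expectation W * prob A"
proof -
  have sub: "sets G \<subseteq> events" "sets H \<subseteq> events"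
    using indep by (auto simp: indep_sets2_eq)
  have rv: "random_variable borel W"
    using W sub sp by (intro measurable_from_subalg[of M H]) (auto simp: subalgebra_def)
  have rvA: "random_variable borel (indicator A :: 'a \<Rightarrow> real)"
    using A sub by auto
  have "sigma_sets (space M) {f -` S \<inter> space M | S. S \<in> sets borel} \<subseteq> sets N"
    if "f \<in> borel_measurable N" "space N = space M" for f :: "'a \<Rightarrow> real" and N
    unfolding that(2)[symmetric] using measurable_sets[OF that(1)]
    by (intro sets.sigma_sets_subset) auto
  from this[OF W] this[of "indicator A" G] have
    "sigma_sets (space M) {W -` S \<inter> space M | S. S \<in> sets borel} \<subseteq> sets H"
    "sigma_sets (space M) {(indicator A :: 'a \<Rightarrow> real) -` S \<inter> space M | S. S \<in> sets borel} \<subseteq> sets G"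
    using A sp by auto
  then have "indep_var borel (indicator A :: 'a \<Rightarrow> real) borel W"
    unfolding indep_var_eq indep_set_def
    by (intro conjI rv rvA indep_sets_mono_sets[OF indep[unfolded indep_set_def]])
      (simp split: bool.split)
  then have "expectation (\<lambda>\<omega>. indicator A \<omega> * W \<omega>) = expectation (indicator A) * expectation W"
    by (rule indep_var_lebesgue_integral)
      (use int A sub in \<open>auto intro!: integrable_real_indicator simp: emeasure_eq_measure\<close>)
  then show ?thesis using sets.sets_into_space[OF A] sp by (simp add: Int_absorb2 mult.commute)
qed

section \<open>Filtration, normalised positions and innovations of the walk\<close>

context elephant_random_walk
begin

text \<open>The sigma-algebra of the first \<open>n\<close> steps, in the form used by
  \<open>choice_indep_past\<close>.\<close>

definition history :: "nat \<Rightarrow> 'a measure" where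
  "history n = vimage_algebra (space M) (\<lambda>\<omega>. \<lambda>i\<in>{1..n}. X i \<omega>) (PiM {1..n} (\<lambda>_. borel))"

lemma space_history [simp]: "space (history n) = space M"
  by (simp add: history_def)

lemma X_history:
  assumes "i \<in> {1..n}"
  shows "X i \<in> borel_measurable (history n)"
proof -
  have "(\<lambda>\<omega>. \<lambda>i\<in>{1..n}. X i \<omega>) \<in> measurable (history n) (PiM {1..n} (\<lambda>_. borel))"
    unfolding history_def by (rule measurable_vimage_algebra1) (auto simp: space_PiM)
  from measurable_compose[OF this measurable_component_singleton[OF assms]] show ?thesis
    using assms by simp
qed

text \<open>Minimality of the generated sigma-algebra; it yields both the subalgebra property and
  monotonicity in \<open>n\<close>.\<close>

lemma history_subset:
  assumes "space N = space M" "\<And>i. i \<in> {1..n} \<Longrightarrow> X i \<in> borel_measurable N"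
  shows "sets (history n) \<subseteq> sets N"
  unfolding history_def using assms
  by (intro sets_image_in_sets measurable_restrict) auto

lemma history_subalgebra: "subalgebra M (history n)"
  using history_subset[of M n] X_measurable by (simp add: subalgebra_def)

lemma history_mono: "m \<le> n \<Longrightarrow> sets (history m) \<subseteq> sets (history n)"
  by (rule history_subset) (auto intro: X_history)

text \<open>Sequences start at index \<open>0\<close>: \<open>ratio n\<close> is \<open>S\<^sub>n\<^sub>+\<^sub>1 / (n + 1)\<close>, known at time \<open>n + 1\<close>, and \<open>noise n\<close>
  is the innovation of the following step \<open>X\<^sub>n\<^sub>+\<^sub>2\<close>.\<close>

definition ratio :: "nat \<Rightarrow> 'a \<Rightarrow> real" where
  "ratio n \<omega> = erw_position X (Suc n) \<omega> / real (Suc n)"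

definition noise :: "nat \<Rightarrow> 'a \<Rightarrow> real" where
  "noise n \<omega> = X (n + 2) \<omega> - (2 * p - 1) * ratio n \<omega>"

lemma ratio_history: "ratio n \<in> borel_measurable (history (Suc n))"
  unfolding ratio_def[abs_def] erw_position_def
  by (intro borel_measurable_divide borel_measurable_sum borel_measurable_const X_history) auto

lemma noise_history: "noise n \<in> borel_measurable (history (n + 2))"
proof -
  have "ratio n \<in> borel_measurable (history (n + 2))"
    using ratio_history[of n] history_mono[of "Suc n" "n + 2"]
    by (intro measurable_from_subalg[of "history (n + 2)" "history (Suc n)"]) (auto simp: subalgebra_def)
  then show ?thesis
    unfolding noise_def[abs_def] by (intro borel_measurable_diff borel_measurable_times X_history) auto
qed

section \<open>Almost sure bounds on steps and innovations\<close>

lemma choice_in_range: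
  assumes "n \<ge> 1"
  shows "AE \<omega> in M. K n \<omega> \<in> {1..n}"
proof -
  have "AE x in measure_pmf (pair_pmf (pmf_of_set {1..n}) (bernoulli_pmf p)). fst x \<in> {1..n}"
    using assms by (auto simp: AE_measure_pmf_iff)
  then show ?thesis
    unfolding choice_law[OF assms, symmetric]
    by (subst (asm) AE_distr_iff[OF choice_measurable[OF assms]]) auto
qed

text \<open>The two first-step probabilities add up to 1. Strong induction does the rest, since the
  remembered time may lie anywhere in \<open>{1..n}\<close>.\<close>

lemma AE_X_unit: "AE \<omega> in M. \<forall>n\<ge>1. \<bar>X n \<omega>\<bar> = 1"
proof -
  have [measurable]: "X (Suc 0) \<in> borel_measurable M" using X_measurable[of 1] by simp
  let ?A = "{\<omega> \<in> space M. X 1 \<omega> = 1}" and ?B = "{\<omega> \<in> space M. X 1 \<omega> = - 1}"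
  have "prob (?A \<union> ?B) = prob ?A + prob ?B"
    by (rule finite_measure_Union) auto
  then have "prob (?A \<union> ?B) = 1" using first_step_pos first_step_neg by simp
  then have "AE \<omega> in M. \<omega> \<in> ?A \<union> ?B" by (subst (asm) prob_eq_1) auto
  moreover have "AE \<omega> in M. \<forall>n. n \<ge> 1 \<longrightarrow> K n \<omega> \<in> {1..n}"
    unfolding AE_all_countable using choice_in_range by auto
  ultimately show ?thesis using AE_space
  proof eventually_elim
    case (elim \<omega>)
    have "\<bar>X n \<omega>\<bar> = 1" if "n \<ge> 1" for n
      using that
    proof (induction n rule: less_induct)
      case (less n)
      show ?case
      proof (cases "n = 1")
        case True
        then show ?thesis using elim(1) by auto
      next
        case False
        then obtain k where k: "n = Suc k" "k \<ge> 1" using less.prems by (cases n) auto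
        then have "\<bar>X (K k \<omega>) \<omega>\<bar> = 1" using less.IH[of "K k \<omega>"] elim(2) by force
        then show ?thesis using next_step[OF k(2) elim(3)] k(1) by simp
      qed
    qed
    then show ?case by blast
  qed
qed

lemma ratio_bounded:
  assumes "\<forall>n\<ge>1. \<bar>X n \<omega>\<bar> = 1"
  shows "\<bar>ratio n \<omega>\<bar> \<le> 1"
proof -
  have "\<bar>erw_position X (Suc n) \<omega>\<bar> \<le> (\<Sum>k=1..Suc n. \<bar>X k \<omega>\<bar>)"
    unfolding erw_position_def by (rule sum_abs)
  also have "\<dots> = (\<Sum>k=1..Suc n. 1)" using assms by (intro sum.cong) auto
  finally show ?thesis by (simp add: ratio_def divide_simps)
qed

lemma drift_bound: "\<bar>2 * p - 1\<bar> \<le> 1"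
  using p_range by auto

lemma AE_noise_bounded: "AE \<omega> in M. \<bar>noise n \<omega>\<bar> \<le> 2"
  using AE_X_unit
proof eventually_elim
  case (elim \<omega>)
  have "\<bar>(2 * p - 1) * ratio n \<omega>\<bar> \<le> 1 * 1"
    unfolding abs_mult by (intro mult_mono drift_bound ratio_bounded elim) auto
  moreover have "\<bar>X (n + 2) \<omega>\<bar> = 1" using elim by simp
  ultimately show ?case unfolding noise_def by linarith
qed

section \<open>Effect of the memory choice on the next step\<close>

lemma prob_choice:
  assumes "n \<ge> 1" "j \<in> {1..n}"
  shows "prob {\<omega> \<in> space M. (K n \<omega>, R n \<omega>) = (j, r)} = (if r then p else 1 - p) / real n"
proof -
  have "prob {\<omega> \<in> space M. (K n \<omega>, R n \<omega>) = (j, r)}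
      = measure (distr M (count_space UNIV) (\<lambda>\<omega>. (K n \<omega>, R n \<omega>))) {(j, r)}"
    using choice_measurable[OF assms(1)]
    by (subst measure_distr) (auto intro!: arg_cong[where f = prob])
  also have "\<dots> = pmf (pair_pmf (pmf_of_set {1..n}) (bernoulli_pmf p)) (j, r)"
    unfolding choice_law[OF assms(1)] by (simp add: measure_pmf_single)
  also have "\<dots> = (if r then p else 1 - p) / real n"
    using assms p_range by (cases r) (auto simp: pmf_pair)
  finally show ?thesis .
qed

text \<open>Independence of the choice from the past factors the expectation, and the product law
  supplies the probability.\<close>

lemma expectation_remembered_step:
  fixes W :: "'a \<Rightarrow> real"
  assumes n: "n \<ge> 1" and j: "j \<in> {1..n}" and W: "W \<in> borel_measurable (history n)"
    and int: "integrable M W"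
  shows "expectation (\<lambda>\<omega>. W \<omega> * indicator {\<omega> \<in> space M. (K n \<omega>, R n \<omega>) = (j, r)} \<omega>)
    = expectation W * ((if r then p else 1 - p) / real n)"
proof -
  let ?G = "vimage_algebra (space M) (\<lambda>\<omega>. (K n \<omega>, R n \<omega>)) (count_space UNIV)"
  have "{\<omega> \<in> space M. (K n \<omega>, R n \<omega>) = (j, r)} = (\<lambda>\<omega>. (K n \<omega>, R n \<omega>)) -` {(j, r)} \<inter> space M"
    by auto
  also have "\<dots> \<in> sets ?G" by (rule in_vimage_algebra) simp
  finally have "expectation (\<lambda>\<omega>. W \<omega> * indicator {\<omega> \<in> space M. (K n \<omega>, R n \<omega>) = (j, r)} \<omega>)
    = expectation W * prob {\<omega> \<in> space M. (K n \<omega>, R n \<omega>) = (j, r)}"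
    using choice_indep_past[OF n] W int
    by (intro expectation_indep_sets[of ?G "history n"]) (auto simp: history_def)
  then show ?thesis unfolding prob_choice[OF n j] .
qed

text \<open>Weak form of the conditional mean \<open>(2 * p - 1) * S_n / n\<close>. Splitting over
  the values of \<open>(K n, R n)\<close>, each \<open>j\<close> contributes with total weight
  \<open>p / n - (1 - p) / n\<close>.\<close>

lemma expectation_next_step:
  fixes W :: "'a \<Rightarrow> real"
  assumes n: "n \<ge> 1" and W: "W \<in> borel_measurable (history n)"
    and B: "AE \<omega> in M. \<bar>W \<omega>\<bar> \<le> B"
  shows "expectation (\<lambda>\<omega>. W \<omega> * X (Suc n) \<omega>)
    = (2 * p - 1) / real n * (\<Sum>j=1..n. expectation (\<lambda>\<omega>. W \<omega> * X j \<omega>))"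
proof -
  let ?I = "\<lambda>j r. indicator {\<omega> \<in> space M. (K n \<omega>, R n \<omega>) = (j, r)} :: 'a \<Rightarrow> real"
  have meas: "(\<lambda>\<omega>. W \<omega> * X j \<omega>) \<in> borel_measurable (history n)" if "j \<in> {1..n}" for j
    using W X_history[OF that] by (rule borel_measurable_times)
  have int: "integrable M (\<lambda>\<omega>. W \<omega> * X j \<omega>)" if "j \<in> {1..n}" for j
  proof (rule integrable_const_bound)
    show "AE \<omega> in M. norm (W \<omega> * X j \<omega>) \<le> B"
      using B AE_X_unit by eventually_elim (use that in \<open>auto simp: abs_mult\<close>)
    show "random_variable borel (\<lambda>\<omega>. W \<omega> * X j \<omega>)"
      by (rule measurable_from_subalg[OF history_subalgebra meas[OF that]])
  qed
  have ev: "{\<omega> \<in> space M. (K n \<omega>, R n \<omega>) = (j, r)} \<in> events" for j r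
    using measurable_sets[OF choice_measurable[OF n], of "{(j, r)}"]
    by (auto simp: vimage_def Int_def conj_commute)
  have intI: "integrable M (\<lambda>\<omega>. W \<omega> * X j \<omega> * ?I j r \<omega>)" if "j \<in> {1..n}" for j r
    using integrable_real_mult_indicator[OF ev int[OF that]] .
  have "expectation (\<lambda>\<omega>. W \<omega> * X (Suc n) \<omega>)
      = expectation (\<lambda>\<omega>. \<Sum>j=1..n. W \<omega> * X j \<omega> * ?I j True \<omega> - W \<omega> * X j \<omega> * ?I j False \<omega>)"
  proof (rule integral_cong_AE)
    show "random_variable borel (\<lambda>\<omega>. W \<omega> * X (Suc n) \<omega>)"
      using measurable_from_subalg[OF history_subalgebra W] X_measurable[of "Suc n"]
      by (intro borel_measurable_times) auto
    show "random_variable borel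
        (\<lambda>\<omega>. \<Sum>j=1..n. W \<omega> * X j \<omega> * ?I j True \<omega> - W \<omega> * X j \<omega> * ?I j False \<omega>)"
      by (intro borel_measurable_sum borel_measurable_diff borel_measurable_integrable intI)
    show "AE \<omega> in M. W \<omega> * X (Suc n) \<omega>
        = (\<Sum>j=1..n. W \<omega> * X j \<omega> * ?I j True \<omega> - W \<omega> * X j \<omega> * ?I j False \<omega>)"
      using choice_in_range[OF n] AE_space
    proof eventually_elim
      case (elim \<omega>)
      \<comment> \<open>Only \<open>j = K n \<omega>\<close> survives, with the sign selected by
        \<open>R n \<omega>\<close>.\<close>
      have "(\<Sum>j=1..n. W \<omega> * X j \<omega> * ?I j True \<omega> - W \<omega> * X j \<omega> * ?I j False \<omega>)
          = (\<Sum>j=1..n. if j = K n \<omega> then W \<omega> * X (Suc n) \<omega> else 0)"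
        using next_step[OF n elim(2)] elim(2) by (intro sum.cong) (auto simp: indicator_def)
      also have "\<dots> = W \<omega> * X (Suc n) \<omega>" using elim(1) by (subst sum.delta) auto
      finally show ?case by simp
    qed
  qed
  also have "\<dots> = (\<Sum>j=1..n. expectation (\<lambda>\<omega>. W \<omega> * X j \<omega> * ?I j True \<omega>)
      - expectation (\<lambda>\<omega>. W \<omega> * X j \<omega> * ?I j False \<omega>))"
    by (simp only: Bochner_Integration.integral_sum[OF Bochner_Integration.integrable_diff[OF intI intI]]
        Bochner_Integration.integral_diff[OF intI intI] cong: sum.cong)
  also have "\<dots> = (\<Sum>j=1..n. expectation (\<lambda>\<omega>. W \<omega> * X j \<omega>) * ((2 * p - 1) / real n))"
  proof (intro sum.cong refl)
    fix j assume j: "j \<in> {1..n}"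
    show "expectation (\<lambda>\<omega>. W \<omega> * X j \<omega> * ?I j True \<omega>) - expectation (\<lambda>\<omega>. W \<omega> * X j \<omega> * ?I j False \<omega>)
        = expectation (\<lambda>\<omega>. W \<omega> * X j \<omega>) * ((2 * p - 1) / real n)"
      unfolding expectation_remembered_step[OF n j meas[OF j] int[OF j]]
      by (simp add: right_diff_distrib[symmetric] diff_divide_distrib[symmetric])
  qed
  finally show ?thesis by (simp add: sum_distrib_left mult.commute)
qed

text \<open>The index shift reflects that \<open>ratio n\<close> is known after \<open>Suc n\<close>
  steps. Orthogonality holds because \<open>expectation_next_step\<close> cancels the drift
  subtracted in \<open>noise\<close>.\<close>

sublocale bounded_martingale_differences M "\<lambda>n. history (Suc n)" noise 2
proof
  show "subalgebra M (history (Suc n))" for n by (rule history_subalgebra)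
  show "sets (history (Suc m)) \<subseteq> sets (history (Suc n))" if "m \<le> n" for m n
    using that by (intro history_mono) simp
  show "noise n \<in> borel_measurable (history (Suc (Suc n)))" for n
    using noise_history[of n] by simp
  show "AE \<omega> in M. \<bar>noise n \<omega>\<bar> \<le> 2" for n by (rule AE_noise_bounded)
  fix n W B assume W: "W \<in> borel_measurable (history (Suc n))" and B: "AE \<omega> in M. \<bar>W \<omega>\<bar> \<le> (B :: real)"
  have int: "integrable M (\<lambda>\<omega>. W \<omega> * X j \<omega>)" if "j \<ge> 1" for j
  proof (rule integrable_const_bound)
    show "AE \<omega> in M. norm (W \<omega> * X j \<omega>) \<le> B"
      using B AE_X_unit by eventually_elim (use that in \<open>auto simp: abs_mult\<close>)
    show "random_variable borel (\<lambda>\<omega>. W \<omega> * X j \<omega>)"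
      using measurable_from_subalg[OF history_subalgebra W] X_measurable[OF that]
      by (intro borel_measurable_times)
  qed
  have "(\<lambda>\<omega>. W \<omega> * noise n \<omega>)
      = (\<lambda>\<omega>. W \<omega> * X (Suc (Suc n)) \<omega> - (2 * p - 1) / real (Suc n) * (\<Sum>j=1..Suc n. W \<omega> * X j \<omega>))"
    by (simp add: noise_def ratio_def erw_position_def fun_eq_iff right_diff_distrib
        sum_distrib_left[symmetric] del: sum.cl_ivl_Suc)
  moreover have "integrable M (\<lambda>\<omega>. \<Sum>j=1..Suc n. W \<omega> * X j \<omega>)"
    by (intro Bochner_Integration.integrable_sum int) auto
  moreover have "expectation (\<lambda>\<omega>. \<Sum>j=1..Suc n. W \<omega> * X j \<omega>)
      = (\<Sum>j=1..Suc n. expectation (\<lambda>\<omega>. W \<omega> * X j \<omega>))"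
    by (intro Bochner_Integration.integral_sum int) auto
  ultimately show "expectation (\<lambda>\<omega>. W \<omega> * noise n \<omega>) = 0"
    using int[of "Suc (Suc n)"] expectation_next_step[of "Suc n", OF _ W B]
    by (simp del: sum.cl_ivl_Suc)
qed

section \<open>Summability of the weighted innovations and the limit of the estimator\<close>

definition weight :: "nat \<Rightarrow> 'a \<Rightarrow> real" where
  "weight n \<omega> = ratio n \<omega> / (1 + (\<Sum>k\<le>n. (ratio k \<omega>)\<^sup>2))"

text \<open>With \<open>c (Suc n)\<close> the denominator of \<open>weight n\<close>, the squared
  ratio is \<open>c (Suc n) - c n\<close>. Lowering one denominator factor to \<open>c n\<close>
  turns the squared weight into the telescoping \<open>1 / c n - 1 / c (Suc n)\<close>.\<close>

lemma weight_square_sum: "(\<Sum>k<n. (weight k \<omega>)\<^sup>2) \<le> 1"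
proof -
  define c where "c n = 1 + (\<Sum>k<n. (ratio k \<omega>)\<^sup>2)" for n
  have c: "c n \<ge> 1" for n by (simp add: c_def sum_nonneg)
  have "(\<Sum>k<n. (weight k \<omega>)\<^sup>2) \<le> 1 - 1 / c n"
  proof (induction n)
    case (Suc n)
    have Suc_c: "c (Suc n) = c n + (ratio n \<omega>)\<^sup>2" by (simp add: c_def)
    have "(weight n \<omega>)\<^sup>2 = (ratio n \<omega>)\<^sup>2 / (c (Suc n) * c (Suc n))"
      by (simp add: weight_def c_def lessThan_Suc_atMost power_divide power2_eq_square)
    also have "\<dots> \<le> (ratio n \<omega>)\<^sup>2 / (c n * c (Suc n))"
      using c[of n] c[of "Suc n"] Suc_c
      by (intro divide_left_mono mult_right_mono mult_pos_pos) auto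
    also have "\<dots> = 1 / c n - 1 / c (Suc n)"
      using c[of n] c[of "Suc n"] Suc_c by (simp add: field_simps)
    finally show ?case using Suc.IH by simp
  qed (simp add: c_def)
  also have "\<dots> \<le> 1" using c[of n] by simp
  finally show ?thesis .
qed

lemma weight_history: "weight n \<in> borel_measurable (history (Suc n))"
  unfolding weight_def[abs_def]
  by (intro borel_measurable_divide borel_measurable_add borel_measurable_const borel_measurable_sum
      borel_measurable_power measurable_filtration[OF ratio_history]) auto

lemma weight_bounded: "\<bar>weight n \<omega>\<bar> \<le> 1"
proof -
  have "(weight n \<omega>)\<^sup>2 \<le> (\<Sum>k<Suc n. (weight k \<omega>)\<^sup>2)" by (simp add: sum_nonneg)
  also have "\<dots> \<le> 1" by (rule weight_square_sum)
  finally show ?thesis by (simp add: abs_square_le_1)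
qed

text \<open>The pathwise bound of the squared weights by 1 survives integration and gives summable
  second moments.\<close>

lemma AE_weighted_noise_summable: "AE \<omega> in M. summable (\<lambda>k. weight k \<omega> * noise k \<omega>)"
proof -
  have W: "weight n \<in> borel_measurable (history (Suc n))" for n by (rule weight_history)
  have B: "AE \<omega> in M. \<bar>weight n \<omega>\<bar> \<le> 1" for n by (simp add: weight_bounded)
  have int: "integrable M (\<lambda>\<omega>. (weight n \<omega>)\<^sup>2)" for n
    by (rule integrable_weight_square[OF W B])
  have "(\<Sum>k<n. expectation (\<lambda>\<omega>. (weight k \<omega>)\<^sup>2)) \<le> 1" for n
  proof -
    have "(\<Sum>k<n. expectation (\<lambda>\<omega>. (weight k \<omega>)\<^sup>2)) = expectation (\<lambda>\<omega>. \<Sum>k<n. (weight k \<omega>)\<^sup>2)"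
      using int by simp
    also have "\<dots> \<le> expectation (\<lambda>_. 1)"
      using int by (intro integral_mono weight_square_sum) auto
    finally show ?thesis by (simp add: prob_space)
  qed
  then have "summable (\<lambda>k. expectation (\<lambda>\<omega>. (weight k \<omega>)\<^sup>2))"
    by (intro summableI_nonneg_bounded[where x = 1]) auto
  from transform_AE_convergent[OF W B this] show ?thesis
    unfolding transform_def summable_iff_convergent .
qed

text \<open>Substituting the innovation, \<open>X (k + 2) + ratio k\<close> becomes
  \<open>2 * p * ratio k + noise k\<close>. The index \<open>n + 2\<close> matches the times
  \<open>1..n + 1\<close> with the ratios \<open>0..n\<close>.\<close>

lemma estimator_eq:
  assumes "(\<Sum>k\<le>n. (ratio k \<omega>)\<^sup>2) > 0"
  shows "erw_estimator X (n + 2) \<omega>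
    = p + (\<Sum>k\<le>n. ratio k \<omega> * noise k \<omega>) / (\<Sum>k\<le>n. (ratio k \<omega>)\<^sup>2) / 2"
proof -
  have shift: "(\<Sum>k=1..n + 2 - 1. f k) = (\<Sum>k\<le>n. f (Suc k))" for f :: "nat \<Rightarrow> real"
    by (simp add: sum.atLeast_Suc_atMost_Suc_shift atLeast0AtMost del: sum.cl_ivl_Suc)
  have "erw_estimator X (n + 2) \<omega> = (\<Sum>k\<le>n. ratio k \<omega> * (X (k + 2) \<omega> + ratio k \<omega>))
      / (2 * (\<Sum>k\<le>n. (ratio k \<omega>)\<^sup>2))"
    unfolding erw_estimator_def shift by (simp add: ratio_def)
  also have "(\<Sum>k\<le>n. ratio k \<omega> * (X (k + 2) \<omega> + ratio k \<omega>))
      = (\<Sum>k\<le>n. 2 * p * (ratio k \<omega>)\<^sup>2 + ratio k \<omega> * noise k \<omega>)"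
    by (intro sum.cong) (auto simp: noise_def power2_eq_square algebra_simps)
  also have "\<dots> = 2 * p * (\<Sum>k\<le>n. (ratio k \<omega>)\<^sup>2) + (\<Sum>k\<le>n. ratio k \<omega> * noise k \<omega>)"
    by (simp add: sum.distrib sum_distrib_left)
  finally show ?thesis using assms by (simp add: field_simps)
qed

lemma estimator_strongly_consistent: "AE \<omega> in M. (\<lambda>n. erw_estimator X n \<omega>) \<longlonglongrightarrow> p"
  using AE_X_unit AE_weighted_noise_summable
proof eventually_elim
  case (elim \<omega>)
  let ?v = "\<lambda>n. \<Sum>k\<le>n. (ratio k \<omega>)\<^sup>2"
  have step: "(2 * p - 1) * ratio n \<omega> + noise n \<omega> = X (n + 2) \<omega>" for n
    by (simp add: noise_def)
  have unit: "((2 * p - 1) * ratio n \<omega> + noise n \<omega>)\<^sup>2 = 1" for n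
    unfolding step using elim(1) by (metis power2_abs one_power2 le_add2 one_le_numeral order_trans)
  \<comment> \<open>This is \<open>S_(n+2) = S_(n+1) + X_(n+2)\<close>, written with normalised
    positions.\<close>
  have rec: "real (n + 2) * ratio (Suc n) \<omega>
      = real (n + 1) * ratio n \<omega> + ((2 * p - 1) * ratio n \<omega> + noise n \<omega>)" for n
    unfolding step by (simp add: ratio_def erw_position_def)
  note lims = normalised_walk_noise_ratio[OF drift_bound unit rec elim(2)[unfolded weight_def]]
  have "eventually (\<lambda>n. ?v n > 0) sequentially"
    using lims(1) by (simp add: filterlim_at_top_dense)
  then have eq: "eventually (\<lambda>n. p + (\<Sum>k\<le>n. ratio k \<omega> * noise k \<omega>) / ?v n / 2
      = erw_estimator X (n + 2) \<omega>) sequentially"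
    by eventually_elim (simp only: estimator_eq)
  have "(\<lambda>n. p + (\<Sum>k\<le>n. ratio k \<omega> * noise k \<omega>) / ?v n / 2) \<longlonglongrightarrow> p + 0 / 2"
    by (intro tendsto_intros lims(2)) simp
  \<comment> \<open>The limit was found along indices shifted by 2; the shift is removed
    here.\<close>
  from Lim_transform_eventually[OF this eq] show ?case
    by (intro LIMSEQ_offset[of "\<lambda>n. erw_estimator X n \<omega>" 2]) simp
qed

end

theorem theorem3p1:
  fixes M :: "'a measure" and p q :: real
    and X :: "nat \<Rightarrow> 'a \<Rightarrow> real" and K :: "nat \<Rightarrow> 'a \<Rightarrow> nat" and R :: "nat \<Rightarrow> 'a \<Rightarrow> bool"
  assumes "elephant_random_walk M p q X K R"
  shows "AE \<omega> in M. (\<lambda>n. erw_estimator X n \<omega>) \<longlonglongrightarrow> p"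
  using elephant_random_walk.estimator_strongly_consistent[OF assms] .

end
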